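(* Let $T\ge 2$, let $L,l$ be integers with $1\le L\le T-1$ and $1\le l\le T-1$, let $0\le\underline{p}\le\overline{p}$, and let $a>0$ and $b,c,h\in\mathbb{R}$. Let $\mathcal{X}$ be the set of all $(\bm{p},\bm{x},\bm{u})$ with $\bm{p}\in\mathbb{R}^T$, $\bm{x}\in\{0,1\}^T$, $\bm{u}=(u_2,\dots,u_T)\in\{0,1\}^{T-1}$ satisfying - $u_t\ge x_t-x_{t-1}$ for all $t\in[2,T]$; - $\sum_{i=t-L+1}^{t}u_i\le x_t$ for all $t\in[L+1,T]$; - $\sum_{i=t-l+1}^{t}u_i\le 1-x_{t-l}$ for all $t\in[l+1,T]$; - $x_t\underline{p}\le p_t\le x_t\overline{p}$ for all $t\in[1,T]$. Let $C:\mathcal{X}\to\mathbb{R}$ be the quadratic cost function $$C(\bm{p},\bm{x},\bm{u})=\sum_{t=1}^{T}\big(a p_t^2+b p_t+c x_t+h u_t\big).$$ Then the convex envelope of $C$ taken over $\mathcal{X}$ is the function $C^{**}:\mathrm{conv}(\mathcal{X})\to\mathbb{R}$ given by $$C^{**}(\bm{p},\bm{x},\bm{u})=\sum_{t=1}^{T}\begin{cases} a\dfrac{p_t^2}{x_t}+b p_t+c x_t+h u_t, & x_t>0,\\[4pt] 0, & x_t=0.\end{cases}$$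
   Context: The start-up variables $u_t$ are defined only for $t=2,\dots,T$; in all sums the term $h u_1$ is absent (read as $0$). Index ranges $[a,b]$ denote integers. The convex envelope of a function $C$ taken over a (possibly non-convex) set $\mathcal{X}$ is the largest convex function on $\mathrm{conv}(\mathcal{X})$ that is an under-estimator of $C$ on $\mathcal{X}$, where $\mathrm{conv}(\cdot)$ is the convex hull. *)

theory Defs
  imports "HOL-Analysis.Analysis" "HOL-Analysis.Finite_Function_Topology"
begin

(* A vector whose entries are indexed by a finite set I of time periods is a finitely supported
   function with keys in I. This is isomorphic to the coordinate space on I as a real vector space,
   and subscripts such as t - L + 1 remain plain natural-number arithmetic. *)
type_synonym tvec = "nat \<Rightarrow>\<^sub>0 real"

abbreviation entry :: "tvec \<Rightarrow> nat \<Rightarrow> real" where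
  "entry \<equiv> Poly_Mapping.lookup"

definition vectors_on :: "nat set \<Rightarrow> tvec set" where
  "vectors_on I = {v. Poly_Mapping.keys v \<subseteq> I}"

(* Natural-number subtraction never truncates: the ranges of t ensure t - 1 \<ge> 1, t - L \<ge> 1
   and t - l \<ge> 1. *)
definition uc_set :: "nat \<Rightarrow> nat \<Rightarrow> nat \<Rightarrow> real \<Rightarrow> real \<Rightarrow> (tvec \<times> tvec \<times> tvec) set" where
  "uc_set T L l pmin pmax =
    {(p, x, u).
       p \<in> vectors_on {1..T} \<and>
       x \<in> vectors_on {1..T} \<and> (\<forall>t\<in>{1..T}. entry x t \<in> {0, 1}) \<and>
       u \<in> vectors_on {2..T} \<and> (\<forall>t\<in>{2..T}. entry u t \<in> {0, 1}) \<and>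
       (\<forall>t\<in>{2..T}. entry u t \<ge> entry x t - entry x (t - 1)) \<and>
       (\<forall>t\<in>{L+1..T}. (\<Sum>i=t-L+1..t. entry u i) \<le> entry x t) \<and>
       (\<forall>t\<in>{l+1..T}. (\<Sum>i=t-l+1..t. entry u i) \<le> 1 - entry x (t - l)) \<and>
       (\<forall>t\<in>{1..T}. entry x t * pmin \<le> entry p t \<and> entry p t \<le> entry x t * pmax)}"

(* There is no start-up variable in period 1. *)
definition startup_cost :: "real \<Rightarrow> tvec \<Rightarrow> nat \<Rightarrow> real" where
  "startup_cost h u t = (if 2 \<le> t then h * entry u t else 0)"

definition uc_cost ::
  "nat \<Rightarrow> real \<Rightarrow> real \<Rightarrow> real \<Rightarrow> real \<Rightarrow> tvec \<times> tvec \<times> tvec \<Rightarrow> real" where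
  "uc_cost T a b c h = (\<lambda>(p, x, u).
     \<Sum>t=1..T. a * (entry p t)\<^sup>2 + b * entry p t + c * entry x t + startup_cost h u t)"

definition uc_envelope ::
  "nat \<Rightarrow> real \<Rightarrow> real \<Rightarrow> real \<Rightarrow> real \<Rightarrow> tvec \<times> tvec \<times> tvec \<Rightarrow> real" where
  "uc_envelope T a b c h = (\<lambda>(p, x, u).
     \<Sum>t=1..T. if entry x t > 0
       then a * ((entry p t)\<^sup>2 / entry x t) + b * entry p t + c * entry x t + startup_cost h u t
       else 0)"

(* F and G matter only on X and on the convex hull of X, respectively. *)
definition is_convex_envelope ::
  "'a::real_vector set \<Rightarrow> ('a \<Rightarrow> real) \<Rightarrow> ('a \<Rightarrow> real) \<Rightarrow> bool" where
  "is_convex_envelope X F G \<longleftrightarrow>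
     convex_on (convex hull X) G \<and> (\<forall>z\<in>X. G z \<le> F z) \<and>
     (\<forall>g. convex_on (convex hull X) g \<and> (\<forall>z\<in>X. g z \<le> F z) \<longrightarrow>
       (\<forall>z\<in>convex hull X. g z \<le> G z))"

end

theory Submission
  imports Defs
begin

text \<open>
  Write a point \<open>(p, x, u)\<close> of the hull as a convex combination of feasible points
  \<open>(p\<^sub>k, x\<^sub>k, u\<^sub>k)\<close>. Keeping the \<open>x\<^sub>k\<close>, \<open>u\<^sub>k\<close> and the weights but replacing the outputs by
  \<open>p\<^sub>k(t) = x\<^sub>k(t) r(t)\<close> with the common rate \<open>r(t) = p(t) / x(t)\<close> again gives feasible points with the
  same barycentre, and the weighted average of their costs is exactly the perspective function.
  So no convex underestimator exceeds the perspective function, which is itself convex.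
\<close>

section \<open>Coordinatewise scaling and convexity of the perspective of the square\<close>

lemma lookup_scaleR [simp]:
  "Poly_Mapping.lookup (c *\<^sub>R v) i = c *\<^sub>R Poly_Mapping.lookup v i" for v :: "'a \<Rightarrow>\<^sub>0 'b::real_vector"
proof -
  \<comment> \<open>Finite support is what lets \<open>lookup\<close> cancel the abstraction
    function in the definition of scaling.\<close>
  have "finite {i. c *\<^sub>R Poly_Mapping.lookup v i \<noteq> 0}"
    by (rule finite_subset [OF _ finite_lookup [of v]]) auto
  then show ?thesis
    by (simp add: scaleR_poly_mapping_def)
qed

text \<open>After clearing denominators the gap is a nonnegative multiple of
  \<open>(p * y - q * x)\<^sup>2\<close>. If one weighted denominator vanishes, so does its
  numerator, and both sides reduce to the other term.\<close>

lemma perspective_square_le: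
  fixes p q x y s t :: real
  assumes "0 \<le> x" "0 \<le> y" "0 \<le> s" "0 \<le> t" "x = 0 \<Longrightarrow> p = 0" "y = 0 \<Longrightarrow> q = 0"
  shows "(s * p + t * q)\<^sup>2 / (s * x + t * y) \<le> s * (p\<^sup>2 / x) + t * (q\<^sup>2 / y)"
proof (cases "s * x = 0 \<or> t * y = 0")
  case True
  then show ?thesis
    using assms by (auto simp: power2_eq_square mult_ac)
next
  case False
  then have pos: "x > 0" "y > 0" "s > 0" "t > 0"
    using assms by (auto simp: order_less_le)
  then have den: "s * x + t * y > 0"
    by (simp add: add_pos_pos)
  have "(s * (p\<^sup>2 / x) + t * (q\<^sup>2 / y)) * (s * x + t * y) - (s * p + t * q)\<^sup>2
      = s * t / (x * y) * (p * y - q * x)\<^sup>2"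
    using pos by (simp add: field_simps power2_eq_square)
  moreover have "s * t / (x * y) * (p * y - q * x)\<^sup>2 \<ge> 0"
    using pos by simp
  ultimately show ?thesis
    using den by (simp add: pos_divide_le_eq)
qed

section \<open>Feasible points and a convex relaxation of their hull\<close>

lemma uc_set_nonneg:
  assumes "(p, x, u) \<in> uc_set T L l pmin pmax"
  shows "t \<in> {1..T} \<Longrightarrow> 0 \<le> entry x t" "t \<in> {2..T} \<Longrightarrow> 0 \<le> entry u t"
proof -
  have "entry x t \<in> {0, 1}" if "t \<in> {1..T}"
    using assms that by (simp add: uc_set_def)
  then show "0 \<le> entry x t" if "t \<in> {1..T}"
    using that by auto
  have "entry u t \<in> {0, 1}" if "t \<in> {2..T}"
    using assms that by (simp add: uc_set_def)
  then show "0 \<le> entry u t" if "t \<in> {2..T}"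
    using that by auto
qed

text \<open>A start-up at \<open>t\<close> plus the net rise of \<open>x\<close> from
  \<open>t\<close> to some \<open>s\<close> is covered by the start-ups in the window of length
  \<open>L\<close> ending at \<open>s\<close>. Their sum is at most \<open>entry x s\<close>, which
  cancels. This makes \<open>u\<close> vanish wherever \<open>x\<close> does, even on the
  hull.\<close>

lemma uc_set_startup_le:
  assumes "(p, x, u) \<in> uc_set T L l pmin pmax" "1 \<le> L" "L \<le> T - 1" "t \<in> {2..T}"
  shows "entry u t \<le> entry x t"
proof -
  \<comment> \<open>For \<open>t \<le> L\<close> there is no minimum up-time constraint at \<open>t\<close>, so the first one is used instead.\<close>
  define s where "s = max t (L + 1)"
  have s: "s \<in> {L+1..T}" "t \<le> s" "s - L + 1 \<le> t" "2 \<le> s - L + 1"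
    using assms(2-4) by (auto simp: s_def)
  have u0: "0 \<le> entry u i" if "i \<in> {2..T}" for i
    using uc_set_nonneg(2) [OF assms(1) that] .
  have "entry x s - entry x t = (\<Sum>i=Suc t..s. entry x i - entry x (i - 1))"
    using sum_telescope'' [OF s(2), of "entry x"] by simp
  also have "\<dots> \<le> (\<Sum>i=Suc t..s. entry u i)"
    using assms(1,4) s by (intro sum_mono) (auto simp: uc_set_def)
  finally have "entry u t + (entry x s - entry x t) \<le> (\<Sum>i=t..s. entry u i)"
    using s by (simp add: sum.atLeast_Suc_atMost)
  \<comment> \<open>Enlarging the range only adds nonnegative terms, since the window starts no
    earlier than period 2.\<close>
  also have "\<dots> \<le> (\<Sum>i=s-L+1..s. entry u i)"
    using s u0 by (intro sum_mono2) auto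
  also have "\<dots> \<le> entry x s"
    using assms(1) s unfolding uc_set_def by blast
  finally show ?thesis
    by simp
qed

text \<open>A convex superset of the hull on which \<open>x\<^sub>t = 0\<close> forces \<open>p\<^sub>t = u\<^sub>t = 0\<close>.\<close>
definition uc_relaxation :: "nat \<Rightarrow> real \<Rightarrow> real \<Rightarrow> (tvec \<times> tvec \<times> tvec) set" where
  "uc_relaxation T pmin pmax =
    {(p, x, u). p \<in> vectors_on {1..T} \<and> x \<in> vectors_on {1..T} \<and>
       (\<forall>t\<in>{1..T}. 0 \<le> entry x t \<and> entry x t * pmin \<le> entry p t \<and> entry p t \<le> entry x t * pmax) \<and>
       (\<forall>t\<in>{2..T}. 0 \<le> entry u t \<and> entry u t \<le> entry x t)}"

lemma vectors_on_iff: "v \<in> vectors_on I \<longleftrightarrow> (\<forall>i. i \<notin> I \<longrightarrow> entry v i = 0)"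
  by (auto simp: vectors_on_def in_keys_iff)

lemma convex_uc_relaxation: "convex (uc_relaxation T pmin pmax)"
proof (rule convexI, clarify)
  fix p x u q y v and r s :: real
  assume A: "(p, x, u) \<in> uc_relaxation T pmin pmax" and B: "(q, y, v) \<in> uc_relaxation T pmin pmax"
    and rs: "0 \<le> r" "0 \<le> s"
  have mono: "r * \<alpha> + s * \<gamma> \<le> r * \<beta> + s * \<delta>" if "\<alpha> \<le> \<beta>" "\<gamma> \<le> \<delta>" for \<alpha> \<beta> \<gamma> \<delta> :: real
    using that rs by (intro add_mono mult_left_mono)
  have "0 \<le> r * entry x t + s * entry y t \<and>
      (r * entry x t + s * entry y t) * pmin \<le> r * entry p t + s * entry q t \<and>
      r * entry p t + s * entry q t \<le> (r * entry x t + s * entry y t) * pmax" if "t \<in> {1..T}" for t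
    using A B that rs unfolding distrib_right mult.assoc
    by (intro conjI mono) (simp_all add: uc_relaxation_def)
  moreover have "0 \<le> r * entry u t + s * entry v t \<and>
      r * entry u t + s * entry v t \<le> r * entry x t + s * entry y t" if "t \<in> {2..T}" for t
    using A B that rs by (intro conjI mono) (simp_all add: uc_relaxation_def)
  ultimately show "r *\<^sub>R (p, x, u) + s *\<^sub>R (q, y, v) \<in> uc_relaxation T pmin pmax"
    using A B by (simp add: uc_relaxation_def vectors_on_iff lookup_add)
qed

lemma convex_hull_uc_set_subset:
  assumes "1 \<le> L" "L \<le> T - 1"
  shows "convex hull uc_set T L l pmin pmax \<subseteq> uc_relaxation T pmin pmax"
proof (rule hull_minimal)
  have "(p, x, u) \<in> uc_relaxation T pmin pmax" if "(p, x, u) \<in> uc_set T L l pmin pmax" for p x u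
    using that uc_set_nonneg [OF that] uc_set_startup_le [OF that assms]
    by (simp add: uc_relaxation_def uc_set_def)
  then show "uc_set T L l pmin pmax \<subseteq> uc_relaxation T pmin pmax"
    by auto
qed (rule convex_uc_relaxation)

lemma uc_relaxation_zero:
  assumes "(p, x, u) \<in> uc_relaxation T pmin pmax" "t \<in> {1..T}" "entry x t = 0"
  shows "entry p t = 0" "startup_cost h u t = 0"
proof -
  have "entry x t * pmin \<le> entry p t" "entry p t \<le> entry x t * pmax"
    using assms(1,2) by (simp_all add: uc_relaxation_def)
  then show "entry p t = 0"
    using assms(3) by simp
  have "0 \<le> entry u t \<and> entry u t \<le> entry x t" if "2 \<le> t"
    using assms(1,2) that by (simp add: uc_relaxation_def)
  then show "startup_cost h u t = 0"
    using assms(3) by (auto simp: startup_cost_def intro: antisym)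
qed

section \<open>The perspective function on the relaxation\<close>

text \<open>On the relaxation, division by zero yielding zero makes the case distinction redundant.\<close>
lemma uc_envelope_eq:
  assumes "(p, x, u) \<in> uc_relaxation T pmin pmax"
  shows "uc_envelope T a b c h (p, x, u) = (\<Sum>t=1..T. a * ((entry p t)\<^sup>2 / entry x t)
           + b * entry p t + c * entry x t + startup_cost h u t)"
  unfolding uc_envelope_def prod.case
proof (rule sum.cong [OF refl])
  fix t assume t: "t \<in> {1..T}"
  then have "0 \<le> entry x t"
    using assms by (simp add: uc_relaxation_def)
  then show "(if entry x t > 0 then a * ((entry p t)\<^sup>2 / entry x t) + b * entry p t
        + c * entry x t + startup_cost h u t else 0)
      = a * ((entry p t)\<^sup>2 / entry x t) + b * entry p t + c * entry x t + startup_cost h u t"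
    using uc_relaxation_zero [OF assms t] by auto
qed

lemma startup_cost_linear:
  "startup_cost h (r *\<^sub>R u + s *\<^sub>R v) t = r * startup_cost h u t + s * startup_cost h v t"
  by (simp add: startup_cost_def lookup_add algebra_simps)

text \<open>In the form without cases, every summand is linear except the quadratic one, which is
  handled period by period by \<open>perspective_square_le\<close>.\<close>

lemma convex_on_uc_envelope:
  assumes "0 \<le> a"
  shows "convex_on (uc_relaxation T pmin pmax) (uc_envelope T a b c h)"
  unfolding convex_on_def
proof (intro conjI convex_uc_relaxation ballI allI impI, clarify)
  fix p x u q y v and r s :: real
  assume A: "(p, x, u) \<in> uc_relaxation T pmin pmax" and B: "(q, y, v) \<in> uc_relaxation T pmin pmax"
    and rs: "0 \<le> r" "0 \<le> s" "r + s = 1"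
  have AB: "r *\<^sub>R (p, x, u) + s *\<^sub>R (q, y, v) \<in> uc_relaxation T pmin pmax"
    using convexD [OF convex_uc_relaxation A B] rs by simp
  have "a * ((r * entry p t + s * entry q t)\<^sup>2 / (r * entry x t + s * entry y t))
      \<le> r * (a * ((entry p t)\<^sup>2 / entry x t)) + s * (a * ((entry q t)\<^sup>2 / entry y t))"
    if t: "t \<in> {1..T}" for t
  proof -
    have "0 \<le> entry x t" "0 \<le> entry y t"
      using A B t by (simp_all add: uc_relaxation_def)
    then have "(r * entry p t + s * entry q t)\<^sup>2 / (r * entry x t + s * entry y t)
        \<le> r * ((entry p t)\<^sup>2 / entry x t) + s * ((entry q t)\<^sup>2 / entry y t)"
      using uc_relaxation_zero [OF A t] uc_relaxation_zero [OF B t] rs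
      by (intro perspective_square_le)
    from mult_left_mono [OF this assms] show ?thesis
      by (simp add: algebra_simps)
  qed
  then show "uc_envelope T a b c h (r *\<^sub>R (p, x, u) + s *\<^sub>R (q, y, v))
      \<le> r * uc_envelope T a b c h (p, x, u) + s * uc_envelope T a b c h (q, y, v)"
    using AB uc_envelope_eq [OF A] uc_envelope_eq [OF B]
    by (simp add: uc_envelope_eq sum_distrib_left sum.distrib [symmetric])
      (intro sum_mono, simp add: startup_cost_linear lookup_add distrib_left mult.left_commute)
qed

text \<open>For binary \<open>x\<close> the division is harmless: either the divisor is 1 or the
  output is 0.\<close>

lemma uc_envelope_eq_cost:
  assumes "(p, x, u) \<in> uc_set T L l pmin pmax" "1 \<le> L" "L \<le> T - 1"
  shows "uc_envelope T a b c h (p, x, u) = uc_cost T a b c h (p, x, u)"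
proof -
  have R: "(p, x, u) \<in> uc_relaxation T pmin pmax"
    using subsetD [OF convex_hull_uc_set_subset [OF assms(2,3)] hull_inc [OF assms(1)]] .
  have "(entry p t)\<^sup>2 / entry x t = (entry p t)\<^sup>2" if t: "t \<in> {1..T}" for t
  proof -
    have "entry x t \<in> {0, 1}"
      using assms(1) t by (simp add: uc_set_def)
    then show ?thesis
      using uc_relaxation_zero(1) [OF R t] by auto
  qed
  then show ?thesis
    by (simp add: uc_envelope_eq [OF R] uc_cost_def)
qed

section \<open>Feasible points rerun at a common rate\<close>

definition outputs_at_rate :: "(nat \<Rightarrow> real) \<Rightarrow> tvec \<Rightarrow> tvec" where
  "outputs_at_rate r x = Poly_Mapping.mapp (\<lambda>t e. e * r t) x"

lemma lookup_outputs_at_rate [simp]: "entry (outputs_at_rate r x) t = entry x t * r t"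
  by (simp add: outputs_at_rate_def lookup_mapp when_def in_keys_iff)

definition run_at_rate ::
    "(nat \<Rightarrow> real) \<Rightarrow> tvec \<times> tvec \<times> tvec \<Rightarrow> tvec \<times> tvec \<times> tvec" where
  "run_at_rate r = (\<lambda>(p, x, u). (outputs_at_rate r x, x, u))"

text \<open>The old outputs are discarded and the new ones depend linearly on \<open>x\<close>,
  because \<open>r\<close> is the same for all points. Convex combinations are therefore
  preserved.\<close>

lemma linear_run_at_rate: "linear (run_at_rate r)"
  by (rule linearI)
    (auto simp: run_at_rate_def lookup_add algebra_simps intro!: poly_mapping_eqI)

lemma run_at_rate_in_uc_set:
  assumes "z \<in> uc_set T L l pmin pmax" "\<And>t. t \<in> {1..T} \<Longrightarrow> pmin \<le> r t \<and> r t \<le> pmax"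
  shows "run_at_rate r z \<in> uc_set T L l pmin pmax"
proof -
  obtain p x u where z: "z = (p, x, u)"
    by (cases z)
  have "entry x t * pmin \<le> entry x t * r t \<and> entry x t * r t \<le> entry x t * pmax"
    if t: "t \<in> {1..T}" for t
  proof -
    have "entry x t \<in> {0, 1}"
      using assms(1) t by (simp add: z uc_set_def)
    then show ?thesis
      using assms(2) [OF t] by auto
  qed
  moreover have "outputs_at_rate r x \<in> vectors_on {1..T}"
    using assms(1) by (simp add: z uc_set_def vectors_on_iff)
  ultimately show ?thesis
    using assms(1) by (simp add: z run_at_rate_def uc_set_def)
qed

text \<open>A linear function that replaces the quadratic cost of rerun points, so that averaging
  over a decomposition amounts to evaluation at the barycentre.\<close>

definition rate_cost ::
    "nat \<Rightarrow> real \<Rightarrow> real \<Rightarrow> real \<Rightarrow> real \<Rightarrow> (nat \<Rightarrow> real) \<Rightarrow> tvec \<times> tvec \<times> tvec \<Rightarrow> real" where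
  "rate_cost T a b c h r = (\<lambda>(p, x, u).
     \<Sum>t=1..T. entry x t * (a * (r t)\<^sup>2 + b * r t + c) + startup_cost h u t)"

lemma linear_rate_cost: "linear (rate_cost T a b c h r)"
proof (rule linearI, goal_cases)
  case (1 z w)
  then show ?case
    using startup_cost_linear [of h 1 _ 1]
    by (cases z, cases w)
      (simp add: rate_cost_def lookup_add distrib_right sum.distrib)
next
  case (2 s z)
  then show ?case
    using startup_cost_linear [of h s _ 0]
    by (cases z) (simp add: rate_cost_def sum_distrib_left distrib_left mult.assoc)
qed

text \<open>Binary entries equal their own squares, so the quadratic term becomes linear in
  \<open>x\<close>.\<close>

lemma uc_cost_run_at_rate:
  assumes "z \<in> uc_set T L l pmin pmax"
  shows "uc_cost T a b c h (run_at_rate r z) = rate_cost T a b c h r z"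
proof -
  obtain p x u where z: "z = (p, x, u)"
    by (cases z)
  have "a * (entry x t * r t)\<^sup>2 + b * (entry x t * r t) + c * entry x t
      = entry x t * (a * (r t)\<^sup>2 + b * r t + c)" if t: "t \<in> {1..T}" for t
  proof -
    have "entry x t \<in> {0, 1}"
      using assms t by (simp add: z uc_set_def)
    then show ?thesis
      by auto
  qed
  then show ?thesis
    by (simp add: z run_at_rate_def uc_cost_def rate_cost_def)
qed

section \<open>Maximality among convex underestimators\<close>

lemma uc_envelope_greatest:
  assumes "1 \<le> L" "L \<le> T - 1" "pmin \<le> pmax"
    and g: "convex_on (convex hull uc_set T L l pmin pmax) g"
    and le: "\<And>z. z \<in> uc_set T L l pmin pmax \<Longrightarrow> g z \<le> uc_cost T a b c h z"
    and z: "z \<in> convex hull uc_set T L l pmin pmax"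
  shows "g z \<le> uc_envelope T a b c h z"
proof -
  let ?X = "uc_set T L l pmin pmax"
  obtain p x u where zeq: "z = (p, x, u)"
    by (cases z)
  have R: "(p, x, u) \<in> uc_relaxation T pmin pmax"
    using subsetD [OF convex_hull_uc_set_subset [OF assms(1,2)] z] by (simp add: zeq)
  obtain S w where S: "finite S" "S \<subseteq> ?X" and w: "\<forall>v\<in>S. 0 \<le> w v" "sum w S = 1"
    and zsum: "(\<Sum>v\<in>S. w v *\<^sub>R v) = z"
    using z unfolding convex_hull_explicit by blast
  \<comment> \<open>Where \<open>x\<^sub>t = 0\<close> any admissible rate will do; a point of weight zero may still have \<open>x\<^sub>t = 1\<close>.\<close>
  define r where "r t = (if entry x t > 0 then entry p t / entry x t else pmin)" for t
  have p_eq: "entry x t * r t = entry p t" and r_bounds: "pmin \<le> r t \<and> r t \<le> pmax"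
    if t: "t \<in> {1..T}" for t
  proof -
    have "0 \<le> entry x t" "entry x t * pmin \<le> entry p t" "entry p t \<le> entry x t * pmax"
      using R t by (simp_all add: uc_relaxation_def)
    then show "entry x t * r t = entry p t" "pmin \<le> r t \<and> r t \<le> pmax"
      using uc_relaxation_zero(1) [OF R t] assms(3)
      by (auto simp: r_def pos_le_divide_eq pos_divide_le_eq mult.commute)
  qed
  have run_in: "run_at_rate r v \<in> ?X" if "v \<in> S" for v
    using S that r_bounds by (intro run_at_rate_in_uc_set) auto
  have "entry (outputs_at_rate r x) t = entry p t" for t
  proof (cases "t \<in> {1..T}")
    case False
    then show ?thesis
      using R by (simp add: uc_relaxation_def vectors_on_iff)
  qed (simp add: p_eq)
  then have "run_at_rate r z = z"
    by (auto simp: run_at_rate_def zeq intro: poly_mapping_eqI)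
  \<comment> \<open>Applying the linear map to the decomposition of its fixed point \<open>z\<close>
    gives a second decomposition with the same weights.\<close>
  then have zrun: "z = (\<Sum>v\<in>S. w v *\<^sub>R run_at_rate r v)"
    by (simp add: zsum [symmetric] linear_sum [OF linear_run_at_rate] linear_scale [OF linear_run_at_rate])
  have "S \<noteq> {}"
    using w by auto
  then have "g z \<le> (\<Sum>v\<in>S. w v * g (run_at_rate r v))"
    unfolding zrun using S w run_in g
    by (intro convex_on_sum) (auto intro: hull_inc)
  also have "\<dots> \<le> (\<Sum>v\<in>S. w v * uc_cost T a b c h (run_at_rate r v))"
    using w run_in le by (intro sum_mono mult_left_mono) auto
  also have "\<dots> = (\<Sum>v\<in>S. w v * rate_cost T a b c h r v)"
    using S by (intro sum.cong refl arg_cong2 [where f = "(*)"] uc_cost_run_at_rate) auto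
  also have "\<dots> = rate_cost T a b c h r z"
    by (simp add: zsum [symmetric] linear_sum [OF linear_rate_cost] linear_scale [OF linear_rate_cost])
  also have "\<dots> = uc_envelope T a b c h z"
    unfolding zeq uc_envelope_eq [OF R] rate_cost_def prod.case
  proof (rule sum.cong [OF refl])
    fix t assume t: "t \<in> {1..T}"
    show "entry x t * (a * (r t)\<^sup>2 + b * r t + c) + startup_cost h u t
        = a * ((entry p t)\<^sup>2 / entry x t) + b * entry p t + c * entry x t + startup_cost h u t"
      \<comment> \<open>Substituting \<open>entry x t * r t\<close> for the output turns the
        quotient into \<open>entry x t * (r t)\<^sup>2\<close>, also when
        \<open>entry x t = 0\<close>.\<close>
      by (simp add: p_eq [OF t, symmetric] power2_eq_square algebra_simps)
  qed
  finally show ?thesis .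
qed

theorem theorem3:
  fixes T L l :: nat and pmin pmax a b c h :: real
  assumes "2 \<le> T"
    and "1 \<le> L" and "L \<le> T - 1"
    and "1 \<le> l" and "l \<le> T - 1"
    and "0 \<le> pmin" and "pmin \<le> pmax"
    and "0 < a"
  shows "is_convex_envelope (uc_set T L l pmin pmax) (uc_cost T a b c h) (uc_envelope T a b c h)"
  unfolding is_convex_envelope_def
proof (intro conjI allI impI ballI)
  show "convex_on (convex hull uc_set T L l pmin pmax) (uc_envelope T a b c h)"
    using assms(8)
    by (intro convex_on_subset [OF convex_on_uc_envelope convex_hull_uc_set_subset [OF assms(2,3)]])
      auto
  show "uc_envelope T a b c h z \<le> uc_cost T a b c h z" if "z \<in> uc_set T L l pmin pmax" for z
    using that uc_envelope_eq_cost [OF _ assms(2,3)] by (cases z) simp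
  show "g z \<le> uc_envelope T a b c h z"
    if "convex_on (convex hull uc_set T L l pmin pmax) g \<and>
        (\<forall>z\<in>uc_set T L l pmin pmax. g z \<le> uc_cost T a b c h z)"
      and "z \<in> convex hull uc_set T L l pmin pmax" for g z
    using that assms(2,3,7) by (intro uc_envelope_greatest) auto
qed

end
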